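(* Let $S$ be a sequence in $\mathbb Z_3$. Then $S$ is an $E$-extremal sequence for $(\mathbb Z_3',\{1\})$ if and only if $S$ is a translate of a sequence which is equivalent to the sequence $(1,1,0,0)$.
   Context: $\mathbb Z_3=\mathbb Z/3\mathbb Z$ as a module over itself and $\mathbb Z_3'=\mathbb Z_3\setminus\{0\}$. A subsequence is a non-empty subfamily of terms in the original order. For non-empty $A,B\subseteq\mathbb Z_n$, a sequence $(x_1,\ldots,x_k)$ is an $(A,B)$-weighted zero-sum sequence if there exist $a_i\in A$, $b_i\in B$ with $\sum a_ix_i=0$ and $\sum b_ia_i=0$. $E_{A,B}(n)$ is the least positive $k$ such that every sequence of length $k$ in $\mathbb Z_n$ has an $(A,B)$-weighted zero-sum subsequence of length $n$; an $E$-extremal sequence for $(A,B)$ is a sequence of length $E_{A,B}(n)-1$ with no such subsequence of length $n$. A translate of $(x_1,\ldots,x_k)$ is $(x_1+x,\ldots,x_k+x)$ for some $x$. Sequences $(x_1,\ldots,x_k)$, $(y_1,\ldots,y_k)$ are equivalent if there exist a permutation $\sigma$ of $[1,k]$ and a unit $u$ with $y_{\sigma(i)}=ux_i$ for all $i$. *)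

theory Defs
  imports
    "HOL-Library.Numeral_Type"
    "HOL-Library.Sublist"
    "HOL-Combinatorics.Permutations"
begin

text \<open>
  The ring of integers modulo n, for n at least 2, is the numeral type \<open>n\<close> with its modular
  arithmetic. The definitions are made for an arbitrary finite commutative ring
  \<open>'a\<close>, with \<open>CARD('a)\<close> in the role of n; the weight sets A, B are meant to be non-empty.
  Sequences are lists, indexed from 0.
\<close>

definition weighted_zero_sum ::
  "'a::{finite,comm_ring_1} set \<Rightarrow> 'a set \<Rightarrow> 'a list \<Rightarrow> bool" where
  "weighted_zero_sum A B xs \<longleftrightarrow>
    (\<exists>a b. (\<forall>i<length xs. a i \<in> A \<and> b i \<in> B) \<and>
      (\<Sum>i<length xs. a i * xs ! i) = 0 \<and>
      (\<Sum>i<length xs. b i * a i) = 0)"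

definition has_full_weighted_zero_sum_subseq ::
  "'a::{finite,comm_ring_1} set \<Rightarrow> 'a set \<Rightarrow> 'a list \<Rightarrow> bool" where
  "has_full_weighted_zero_sum_subseq A B xs \<longleftrightarrow>
    (\<exists>ys. subseq ys xs \<and> length ys = CARD('a) \<and> weighted_zero_sum A B ys)"

text \<open>
  For non-empty A and B such a number exists: a sequence with more than \<open>(n - 1) * n\<close> terms,
  \<open>n = CARD('a)\<close>, has n equal terms, and constant weights work for these.
\<close>

definition E_const :: "'a::{finite,comm_ring_1} set \<Rightarrow> 'a set \<Rightarrow> nat" where
  "E_const A B =
    (LEAST k. 0 < k \<and>
      (\<forall>xs :: 'a list. length xs = k \<longrightarrow> has_full_weighted_zero_sum_subseq A B xs))"

definition E_extremal ::
  "'a::{finite,comm_ring_1} set \<Rightarrow> 'a set \<Rightarrow> 'a list \<Rightarrow> bool" where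
  "E_extremal A B xs \<longleftrightarrow>
    length xs = E_const A B - 1 \<and> \<not> has_full_weighted_zero_sum_subseq A B xs"

definition is_translate_of :: "'a::comm_ring_1 list \<Rightarrow> 'a list \<Rightarrow> bool" where
  "is_translate_of ys xs \<longleftrightarrow> (\<exists>x. ys = map (\<lambda>t. t + x) xs)"

definition seq_equivalent :: "'a::comm_ring_1 list \<Rightarrow> 'a list \<Rightarrow> bool" where
  "seq_equivalent xs ys \<longleftrightarrow>
    length xs = length ys \<and>
    (\<exists>\<sigma> u. \<sigma> permutes {..<length xs} \<and> u dvd 1 \<and>
      (\<forall>i<length xs. ys ! \<sigma> i = u * xs ! i))"

end

theory Submission
  imports Defs
begin

text \<open>
  Three non-zero elements of \<open>\<int>/3\<close> sum to zero only if they are equal, so three terms form a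
  weighted zero-sum sequence exactly when their plain sum vanishes, i.e. when they are all equal or
  pairwise distinct. A sequence avoiding this takes at most two values, each at most twice. Hence
  the constant is 5 and the extremal sequences are the rearrangements of \<open>(a, a, b, b)\<close>, \<open>a \<noteq> b\<close>;
  these are the images of \<open>(1, 1, 0, 0)\<close> under \<open>x \<mapsto> u x + b\<close> with \<open>u = a - b\<close>.
\<close>

lemma Z3_cases:
  fixes x :: 3
  obtains "x = 0" | "x = 1" | "x = 2"
proof (cases x)
  case (of_int z)
  then have "z = 0 \<or> z = 1 \<or> z = 2" by auto
  with of_int that show ?thesis by auto
qed

text \<open>In \<int>/3 both \<open>3 * x\<close> and \<open>0 + 1 + 2\<close> vanish, while
  \<open>x + x + y = 0\<close> forces \<open>y = x\<close>. This turns sums into pure equality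
  patterns.\<close>

lemma Z3_sum_eq_0_iff:
  fixes x y z :: 3
  shows "x + y + z = 0 \<longleftrightarrow> x = y \<and> y = z \<or> x \<noteq> y \<and> y \<noteq> z \<and> x \<noteq> z"
  by (cases x rule: Z3_cases; cases y rule: Z3_cases; cases z rule: Z3_cases) simp_all

text \<open>The units are 1 and -1, so each is its own inverse; this serves to cancel a weight and
  to undo a scaling.\<close>

lemma Z3_nonzero_square:
  fixes x :: 3
  assumes "x \<noteq> 0"
  shows "x * x = 1"
  using assms by (cases x rule: Z3_cases) simp_all

lemma Z3_dvd_1_iff:
  fixes x :: 3
  shows "x dvd 1 \<longleftrightarrow> x \<noteq> 0"
  using Z3_nonzero_square[of x] by (metis dvd_triv_left dvd_0_left zero_neq_one)

lemma Z3_weighted_zero_sum_iff: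
  fixes x y z :: 3
  shows "weighted_zero_sum (UNIV - {0}) {1} [x, y, z] \<longleftrightarrow> x + y + z = 0"
proof
  assume "weighted_zero_sum (UNIV - {0}) {1} [x, y, z]"
  then obtain a b where ab: "\<forall>i<length [x, y, z]. a i \<in> UNIV - {0} \<and> b i \<in> {1 :: 3}"
    and x: "(\<Sum>i<length [x, y, z]. a i * [x, y, z] ! i) = 0"
    and a: "(\<Sum>i<length [x, y, z]. b i * a i) = 0"
    unfolding weighted_zero_sum_def by blast
  have nz: "a 0 \<noteq> 0" "a 1 \<noteq> 0" "a 2 \<noteq> 0" and "b 0 = 1" "b 1 = 1" "b 2 = 1"
    using ab by auto
  then have "a 0 + a 1 + a 2 = 0"
    using a by (simp add: numeral_2_eq_2)
  \<comment> \<open>Only two non-zero values exist, so the weights cannot be pairwise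
    distinct.\<close>
  then have "a 1 = a 0 \<and> a 2 = a 0"
    using nz unfolding Z3_sum_eq_0_iff by (metis Z3_cases)
  then have "a 0 * (x + y + z) = 0"
    using x by (simp add: numeral_2_eq_2 algebra_simps)
  then have "a 0 * a 0 * (x + y + z) = 0"
    by (simp add: mult.assoc)
  then show "x + y + z = 0"
    using Z3_nonzero_square[OF nz(1)] by simp
next
  assume "x + y + z = 0"
  then show "weighted_zero_sum (UNIV - {0}) {1} [x, y, z]"
    unfolding weighted_zero_sum_def
    \<comment> \<open>Both families are constantly 1; the condition on the weights becomes
      \<open>1 + 1 + 1 = 0\<close>.\<close>
    by (intro exI[of _ "\<lambda>_. 1"]) (simp add: algebra_simps)
qed

text \<open>Ranging over \<open>subseqs\<close> lets the simplifier enumerate the candidates of an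
  explicit list.\<close>

lemma Z3_has_full_iff:
  fixes xs :: "3 list"
  shows "has_full_weighted_zero_sum_subseq (UNIV - {0}) {1} xs \<longleftrightarrow>
    (\<exists>ys\<in>set (subseqs xs). length ys = 3 \<and> sum_list ys = 0)"
proof -
  have "weighted_zero_sum (UNIV - {0}) {1} ys \<longleftrightarrow> sum_list ys = 0" if "length ys = 3" for ys :: "3 list"
    using that by (auto simp: numeral_3_eq_3 length_Suc_conv Z3_weighted_zero_sum_iff add.assoc)
  then show ?thesis
    unfolding has_full_weighted_zero_sum_subseq_def by auto
qed

lemma Z3_has_full_4_iff:
  fixes a b c d :: 3
  shows "has_full_weighted_zero_sum_subseq (UNIV - {0}) {1} [a, b, c, d] \<longleftrightarrow>
    a + b + c = 0 \<or> a + b + d = 0 \<or> a + c + d = 0 \<or> b + c + d = 0"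
  by (auto simp: Z3_has_full_iff Let_def add.assoc)

lemma has_full_weighted_zero_sum_subseq_mono:
  assumes "subseq xs ys" "has_full_weighted_zero_sum_subseq A B xs"
  shows "has_full_weighted_zero_sum_subseq A B ys"
  using assms subseq_order.trans unfolding has_full_weighted_zero_sum_subseq_def by blast

lemma Z3_not_full_4_iff:
  fixes S :: "3 list"
  assumes "length S = 4"
  shows "\<not> has_full_weighted_zero_sum_subseq (UNIV - {0}) {1} S \<longleftrightarrow>
    (\<exists>a b. a \<noteq> b \<and> mset S = {#a, a, b, b#})"
proof -
  obtain a b c d where S: "S = [a, b, c, d]"
    using assms by (auto simp: numeral_eq_Suc length_Suc_conv)
  show ?thesis
  proof
    assume "\<not> has_full_weighted_zero_sum_subseq (UNIV - {0}) {1} S"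
    \<comment> \<open>Each of the four triples has exactly two equal terms, which leaves only the
      three ways to pair up the positions.\<close>
    then have "a = b \<and> c = d \<and> a \<noteq> c \<or> a = c \<and> b = d \<and> a \<noteq> b \<or> a = d \<and> b = c \<and> a \<noteq> b"
      unfolding S Z3_has_full_4_iff Z3_sum_eq_0_iff by metis
    then show "\<exists>a b. a \<noteq> b \<and> mset S = {#a, a, b, b#}"
      unfolding S by (elim disjE) (force simp: add_mset_commute)+
  next
    assume "\<exists>a b. a \<noteq> b \<and> mset S = {#a, a, b, b#}"
    then show "\<not> has_full_weighted_zero_sum_subseq (UNIV - {0}) {1} S"
      unfolding S Z3_has_full_4_iff Z3_sum_eq_0_iff
      by (auto simp: add_eq_conv_ex)
  qed
qed

lemma Z3_has_full_5:
  fixes xs :: "3 list"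
  assumes "length xs = 5"
  shows "has_full_weighted_zero_sum_subseq (UNIV - {0}) {1} xs"
proof -
  obtain a b c d e where xs: "xs = [a, b, c, d, e]"
    using assms by (auto simp: numeral_eq_Suc length_Suc_conv)
  have sub: "subseq [a, b, c, d] xs" "subseq [a, b, c, e] xs" "subseq [a, b, d, e] xs"
    "subseq [a, c, d, e] xs"
    unfolding xs by simp_all
  \<comment> \<open>These four subsequences contain every triple of positions. Among five terms some
    value occurs three times or all three values occur.\<close>
  have "has_full_weighted_zero_sum_subseq (UNIV - {0}) {1} [a, b, c, d] \<or>
    has_full_weighted_zero_sum_subseq (UNIV - {0}) {1} [a, b, c, e] \<or>
    has_full_weighted_zero_sum_subseq (UNIV - {0}) {1} [a, b, d, e] \<or>
    has_full_weighted_zero_sum_subseq (UNIV - {0}) {1} [a, c, d, e]"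
    unfolding Z3_has_full_4_iff
    by (cases a rule: Z3_cases; cases b rule: Z3_cases; cases c rule: Z3_cases;
        cases d rule: Z3_cases; cases e rule: Z3_cases) simp_all
  then show ?thesis
    using sub has_full_weighted_zero_sum_subseq_mono by blast
qed

lemma Z3_E_const: "E_const (UNIV - {0 :: 3}) {1} = 5"
  unfolding E_const_def
proof (rule Least_equality)
  show "0 < (5 :: nat) \<and> (\<forall>xs :: 3 list. length xs = 5 \<longrightarrow>
      has_full_weighted_zero_sum_subseq (UNIV - {0}) {1} xs)"
    using Z3_has_full_5 by simp
next
  fix k :: nat
  assume k: "0 < k \<and> (\<forall>xs :: 3 list. length xs = k \<longrightarrow>
      has_full_weighted_zero_sum_subseq (UNIV - {0}) {1} xs)"
  show "5 \<le> k"
  proof (rule ccontr)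
    assume "\<not> 5 \<le> k"
    \<comment> \<open>For \<open>k \<le> 4\<close> this prefix has length exactly \<open>k\<close>,
      so one sequence rules out all smaller lengths.\<close>
    then have "has_full_weighted_zero_sum_subseq (UNIV - {0}) {1} (take k [1, 1, 0, 0 :: 3])"
      using k by simp
    then have "has_full_weighted_zero_sum_subseq (UNIV - {0}) {1} [1, 1, 0, 0 :: 3]"
      using has_full_weighted_zero_sum_subseq_mono[OF prefix_imp_subseq[OF take_is_prefix]] by blast
    then show False
      by (simp add: Z3_has_full_4_iff)
  qed
qed

text \<open>Entry \<open>i\<close> of \<open>permute_list \<sigma> ys\<close> is
  \<open>ys ! \<sigma> i\<close>, so the index permutation can be traded for an equality of
  multisets.\<close>

lemma seq_equivalent_iff_mset:
  "seq_equivalent xs ys \<longleftrightarrow> (\<exists>u. u dvd 1 \<and> mset (map ((*) u) xs) = mset ys)"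
proof
  assume "seq_equivalent xs ys"
  then obtain \<sigma> u where len: "length xs = length ys" and \<sigma>: "\<sigma> permutes {..<length ys}"
    and u: "u dvd 1" and nth: "\<forall>i<length xs. ys ! \<sigma> i = u * xs ! i"
    unfolding seq_equivalent_def by auto
  have "map ((*) u) xs = permute_list \<sigma> ys"
    using len nth \<sigma> by (intro nth_equalityI) (auto simp: permute_list_nth)
  then have "mset (map ((*) u) xs) = mset ys"
    using mset_permute_list[OF \<sigma>] by simp
  with u show "\<exists>u. u dvd 1 \<and> mset (map ((*) u) xs) = mset ys"
    by blast
next
  assume "\<exists>u. u dvd 1 \<and> mset (map ((*) u) xs) = mset ys"
  then obtain u where u: "u dvd 1" and mset: "mset (map ((*) u) xs) = mset ys"
    by blast
  have len: "length xs = length ys"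
    using mset_eq_length[OF mset] by simp
  obtain \<sigma> where \<sigma>: "\<sigma> permutes {..<length ys}" and eq: "permute_list \<sigma> ys = map ((*) u) xs"
    using mset_eq_permutation[OF mset] by blast
  have "ys ! \<sigma> i = u * xs ! i" if "i < length xs" for i
    using permute_list_nth[OF \<sigma>, of i] that len by (simp add: eq)
  with u len \<sigma> show "seq_equivalent xs ys"
    unfolding seq_equivalent_def by auto
qed

lemma Z3_translate_equivalent_iff:
  fixes S :: "3 list"
  shows "(\<exists>T. seq_equivalent T [1, 1, 0, 0] \<and> is_translate_of S T) \<longleftrightarrow>
    (\<exists>a b. a \<noteq> b \<and> mset S = {#a, a, b, b#})"
proof
  assume "\<exists>T. seq_equivalent T [1, 1, 0, 0] \<and> is_translate_of S T"
  then obtain T u x where u: "u \<noteq> 0" and T: "mset (map ((*) u) T) = mset [1, 1, 0, 0]"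
    and S: "S = map (\<lambda>t. t + x) T"
    unfolding seq_equivalent_iff_mset is_translate_of_def Z3_dvd_1_iff by blast
  \<comment> \<open>Since \<open>u * u = 1\<close>, applying \<open>u\<close> again to the scaled
    terms recovers those of \<open>T\<close>.\<close>
  have "mset S = image_mset (\<lambda>t. u * t + x) (mset (map ((*) u) T))"
    unfolding S by (simp add: multiset.map_comp comp_def mult.assoc[symmetric] Z3_nonzero_square[OF u])
  also have "\<dots> = {#u + x, u + x, x, x#}"
    unfolding T by simp
  finally show "\<exists>a b. a \<noteq> b \<and> mset S = {#a, a, b, b#}"
    using u by (intro exI[of _ "u + x"] exI[of _ x]) simp
next
  assume "\<exists>a b. a \<noteq> b \<and> mset S = {#a, a, b, b#}"
  then obtain a b where ab: "a \<noteq> b" and S: "mset S = {#a, a, b, b#}"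
    by blast
  \<comment> \<open>The shift sends \<open>b\<close> to 0 and \<open>a\<close> to
    \<open>a - b\<close>; scaling by \<open>a - b\<close> then gives its square, which is 1.\<close>
  define T where "T = map (\<lambda>t. t - b) S"
  have "mset (map ((*) (a - b)) T) = image_mset (\<lambda>t. (a - b) * (t - b)) (mset S)"
    unfolding T_def by (simp add: multiset.map_comp comp_def)
  also have "\<dots> = mset [1, 1, 0, 0]"
    unfolding S using ab by (simp add: Z3_nonzero_square)
  finally have "seq_equivalent T [1, 1, 0, 0]"
    unfolding seq_equivalent_iff_mset Z3_dvd_1_iff using ab by (intro exI[of _ "a - b"]) simp
  moreover have "is_translate_of S T"
    unfolding is_translate_of_def T_def by (intro exI[of _ b]) (simp add: comp_def)
  ultimately show "\<exists>T. seq_equivalent T [1, 1, 0, 0] \<and> is_translate_of S T"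
    by blast
qed

theorem theorem12:
  fixes S :: "3 list"
  shows "E_extremal (UNIV - {0}) {1} S \<longleftrightarrow>
    (\<exists>T. seq_equivalent T [1, 1, 0, 0] \<and> is_translate_of S T)"
proof -
  \<comment> \<open>Extremality also demands length \<open>5 - 1\<close>, which the multiset form
    already fixes.\<close>
  have "length S = 4" if "mset S = {#a, a, b, b#}" for a b
    using arg_cong[OF that, of size] by simp
  then show ?thesis
    unfolding E_extremal_def Z3_E_const Z3_translate_equivalent_iff
    using Z3_not_full_4_iff[of S] by auto
qed

end
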